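(* Let $G$ be a $\overline{C}$-group with a fixed $\overline{C}$-type presentation $\Pi$. Then there is a group isomorphism $$A(G)\ \cong\ G^{\mathcal{D}}\times\mathbb{Z}^{\mathfrak{C}_{\mathrm{ng}}(G)},$$ where $\mathfrak{C}_{\mathrm{ng}}(G)$ is the set of conjugacy classes of $G$ containing no generators from $\Pi$.
   Context: For a quandle $(Q,\triangleleft)$, its structure group is $\mathrm{As}(Q)=\langle e_a,\ a\in Q\mid e_ae_b=e_be_{a\triangleleft b},\ a,b\in Q\rangle$. A group $G$ is a quandle $\mathrm{Conj}(G)$ with $a\triangleleft b=b^{-1}ab$; put $A(G)=\mathrm{As}(\mathrm{Conj}(G))$. For a set $X$, $\mathbb{Z}^{X}$ denotes the free abelian group with basis $X$ (direct sum). A $\overline{C}$-group is a group $G$ admitting a presentation $\Pi$ (a $\overline{C}$-type presentation), with some generator set $\Gamma$, in which every relation is either a conjugation relation $b^{-1}ab=c$ with $a,b,c\in\Gamma$, or a power relation $a^k=1$ with $a\in\Gamma$, $k\ge 2$; there is at most one power relation per conjugacy class of $G$ (i.e., for each conjugacy class $\mathcal{O}$ of $G$, at most one power relation $a^k=1$ has $a\in\mathcal{O}$). The Dehn quandle $\Gamma^G$ is the union of the $G$-conjugacy classes of the elements of $\Gamma$ in $G$, a subquandle of $\mathrm{Conj}(G)$, and $G^{\mathcal{D}}:=\mathrm{As}(\Gamma^G)$. *)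

theory Defs
  imports "HOL-Algebra.Group" "HOL-Algebra.Free_Abelian_Groups"
begin

section \<open>Groups given by generators and relations\<close>

text \<open>A letter \<open>(x, True)\<close> stands for the generator \<open>x\<close>, and \<open>(x, False)\<close> for its formal inverse.
  A pair of words \<open>(l, r)\<close> stands for the relation \<open>l = r\<close>.\<close>

type_synonym 'x word = "('x \<times> bool) list"

definition words :: "'x set \<Rightarrow> 'x word set" where
  "words X = lists (X \<times> UNIV)"

inductive word_eq :: "'x set \<Rightarrow> ('x word \<times> 'x word) set \<Rightarrow> 'x word \<Rightarrow> 'x word \<Rightarrow> bool"
  for X R where
  refl: "u \<in> words X \<Longrightarrow> word_eq X R u u"
| sym: "word_eq X R u v \<Longrightarrow> word_eq X R v u"
| trans: "word_eq X R u v \<Longrightarrow> word_eq X R v w \<Longrightarrow> word_eq X R u w"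
| append: "word_eq X R u u' \<Longrightarrow> word_eq X R v v' \<Longrightarrow> word_eq X R (u @ v) (u' @ v')"
| cancel: "x \<in> X \<Longrightarrow> word_eq X R [(x, b), (x, \<not> b)] []"
| rel: "(l, r) \<in> R \<Longrightarrow> l \<in> words X \<Longrightarrow> r \<in> words X \<Longrightarrow> word_eq X R l r"

definition word_class :: "'x set \<Rightarrow> ('x word \<times> 'x word) set \<Rightarrow> 'x word \<Rightarrow> 'x word set" where
  "word_class X R u = {v. word_eq X R u v}"

definition presented_group :: "'x set \<Rightarrow> ('x word \<times> 'x word) set \<Rightarrow> 'x word set monoid" where
  "presented_group X R =
    \<lparr>carrier = word_class X R ` words X,
     monoid.mult = (\<lambda>A B. {w. \<exists>u\<in>A. \<exists>v\<in>B. word_eq X R (u @ v) w}),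
     one = word_class X R []\<rparr>"

text \<open>\<open>\<langle>X | R\<rangle>\<close> is a presentation of \<open>G\<close>, the generator \<open>x\<close> naming the element \<open>\<iota> x\<close> of \<open>G\<close>.
  The map \<open>\<iota>\<close> is not required to be injective: distinct generators may name the same element.\<close>

definition is_presentation ::
  "('a, 'm) monoid_scheme \<Rightarrow> 'x set \<Rightarrow> ('x word \<times> 'x word) set \<Rightarrow> ('x \<Rightarrow> 'a) \<Rightarrow> bool" where
  "is_presentation G X R \<iota> \<longleftrightarrow>
     R \<subseteq> words X \<times> words X \<and>
     (\<exists>\<phi> \<in> iso (presented_group X R) G. \<forall>x\<in>X. \<phi> (word_class X R [(x, True)]) = \<iota> x)"

lemma words_simps [simp]:
  "[] \<in> words X"
  "p # u \<in> words X \<longleftrightarrow> fst p \<in> X \<and> u \<in> words X"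
  "u @ v \<in> words X \<longleftrightarrow> u \<in> words X \<and> v \<in> words X"
  by (auto simp: words_def mem_Times_iff)

lemma word_eq_words: "word_eq X R u v \<Longrightarrow> u \<in> words X \<and> v \<in> words X"
  by (induction rule: word_eq.induct) auto

lemma word_class_eq_iff:
  assumes "v \<in> words X"
  shows "word_class X R u = word_class X R v \<longleftrightarrow> word_eq X R u v"
  using assms unfolding word_class_def
  by (blast intro: word_eq.refl word_eq.sym word_eq.trans)

lemma presented_group_mult:
  assumes "u \<in> words X" "v \<in> words X"
  shows "word_class X R u \<otimes>\<^bsub>presented_group X R\<^esub> word_class X R v = word_class X R (u @ v)"
  using assms unfolding word_class_def presented_group_def
  by (auto intro: word_eq.refl word_eq.trans word_eq.append)

lemma word_eq_inverse:
  "u \<in> words X \<Longrightarrow>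
    word_eq X R (map (\<lambda>(x, b). (x, \<not> b)) (rev u) @ u) []"
proof (induction u)
  case Nil
  then show ?case by (auto intro: word_eq.refl)
next
  case (Cons p u)
  obtain x b where p: "p = (x, b)" by (cases p)
  let ?i = "map (\<lambda>(x, b). (x, \<not> b)) (rev u)"
  from Cons have u: "u \<in> words X" and x: "x \<in> X"
    and IH: "word_eq X R (?i @ u) []" by (auto simp: p)
  have i: "?i \<in> words X" using word_eq_words[OF IH] by simp
  have "word_eq X R [(x, \<not> b), (x, b)] []"
    using word_eq.cancel[OF x, of R "\<not> b"] by simp
  from word_eq.append[OF word_eq.append[OF word_eq.refl[OF i] this] word_eq.refl[OF u]]
  have "word_eq X R (?i @ [(x, \<not> b), (x, b)] @ u) (?i @ u)" by simp
  from word_eq.trans[OF this IH] show ?case by (simp add: p)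
qed

lemma group_presented_group: "group (presented_group X R)"
proof (rule groupI)
  let ?P = "presented_group X R"
  have car: "carrier ?P = word_class X R ` words X"
    and one: "\<one>\<^bsub>?P\<^esub> = word_class X R []" by (simp_all add: presented_group_def)
  show "a \<otimes>\<^bsub>?P\<^esub> b \<in> carrier ?P" if "a \<in> carrier ?P" "b \<in> carrier ?P" for a b
    using that by (auto simp: car presented_group_mult)
  show "\<one>\<^bsub>?P\<^esub> \<in> carrier ?P" by (simp add: car one)
  show "a \<otimes>\<^bsub>?P\<^esub> b \<otimes>\<^bsub>?P\<^esub> c = a \<otimes>\<^bsub>?P\<^esub> (b \<otimes>\<^bsub>?P\<^esub> c)"
    if "a \<in> carrier ?P" "b \<in> carrier ?P" "c \<in> carrier ?P" for a b c
    using that by (auto simp: car presented_group_mult)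
  show "\<one>\<^bsub>?P\<^esub> \<otimes>\<^bsub>?P\<^esub> a = a" if "a \<in> carrier ?P" for a
    using that by (auto simp: car one presented_group_mult)
  show "\<exists>b\<in>carrier ?P. b \<otimes>\<^bsub>?P\<^esub> a = \<one>\<^bsub>?P\<^esub>" if "a \<in> carrier ?P" for a
  proof -
    from that obtain u where u: "u \<in> words X" "a = word_class X R u" by (auto simp: car)
    have e: "word_eq X R (map (\<lambda>(x, b). (x, \<not> b)) (rev u) @ u) []"
      by (rule word_eq_inverse[OF u(1)])
    then have "map (\<lambda>(x, b). (x, \<not> b)) (rev u) \<in> words X"
      by (auto dest: word_eq_words)
    with e u show ?thesis
      by (auto simp: car one presented_group_mult word_class_eq_iff)
  qed
qed

primrec eval_word :: "('a, 'm) monoid_scheme \<Rightarrow> ('x \<Rightarrow> 'a) \<Rightarrow> 'x word \<Rightarrow> 'a" where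
  "eval_word G f [] = \<one>\<^bsub>G\<^esub>"
| "eval_word G f (p # u) =
    (if snd p then f (fst p) else inv\<^bsub>G\<^esub> f (fst p)) \<otimes>\<^bsub>G\<^esub> eval_word G f u"

lemma presented_group_universal:
  assumes G: "group G" and f: "f \<in> X \<rightarrow> carrier G"
    and R: "\<And>l r. (l, r) \<in> R \<Longrightarrow> l \<in> words X \<Longrightarrow> r \<in> words X
                \<Longrightarrow> eval_word G f l = eval_word G f r"
  shows "\<exists>h \<in> hom (presented_group X R) G.
           \<forall>u \<in> words X. h (word_class X R u) = eval_word G f u"
proof -
  interpret G: group G by (rule G)
  have cl: "eval_word G f u \<in> carrier G" if "u \<in> words X" for u
    using that f by (induction u) (auto simp: Pi_iff)
  have app: "eval_word G f (u @ v) = eval_word G f u \<otimes>\<^bsub>G\<^esub> eval_word G f v"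
    if "u \<in> words X" "v \<in> words X" for u v
    using that f by (induction u) (auto simp: Pi_iff cl G.m_assoc)
  have eq: "eval_word G f u = eval_word G f v" if "word_eq X R u v" for u v
    using that
  proof (induction rule: word_eq.induct)
    case (append u u' v v')
    then show ?case by (auto simp: app dest!: word_eq_words)
  next
    case (cancel x b)
    then show ?case using f by (cases b) (auto simp: Pi_iff)
  qed (auto intro: R)
  define h where "h A = eval_word G f (SOME u. u \<in> A)" for A
  have h: "h (word_class X R u) = eval_word G f u" if "u \<in> words X" for u
  proof -
    have "u \<in> word_class X R u" using that by (auto simp: word_class_def intro: word_eq.refl)
    then have "(SOME v. v \<in> word_class X R u) \<in> word_class X R u" by (rule someI)
    then show ?thesis by (simp add: h_def word_class_def eq)
  qed
  have "h \<in> hom (presented_group X R) G"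
  proof (rule homI)
    fix A B assume "A \<in> carrier (presented_group X R)" "B \<in> carrier (presented_group X R)"
    then obtain u v where uv: "u \<in> words X" "v \<in> words X"
      "A = word_class X R u" "B = word_class X R v"
      by (auto simp: presented_group_def)
    then show "h (A \<otimes>\<^bsub>presented_group X R\<^esub> B) = h A \<otimes>\<^bsub>G\<^esub> h B"
      by (simp add: presented_group_mult h app)
  qed (auto simp: presented_group_def h cl)
  with h show ?thesis by blast
qed


section \<open>Quandles and their structure groups\<close>

record 'a qdl = "'a partial_object" +
  qop :: "'a \<Rightarrow> 'a \<Rightarrow> 'a" (infixl \<open>\<lhd>\<^sub>q\<index>\<close> 70)

locale quandle =
  fixes Q (structure)
  assumes closed: "a \<in> carrier Q \<Longrightarrow> b \<in> carrier Q \<Longrightarrow> a \<lhd>\<^sub>q b \<in> carrier Q"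
    and idem: "a \<in> carrier Q \<Longrightarrow> a \<lhd>\<^sub>q a = a"
    and bij: "b \<in> carrier Q \<Longrightarrow> bij_betw (\<lambda>a. a \<lhd>\<^sub>q b) (carrier Q) (carrier Q)"
    and self_distrib: "a \<in> carrier Q \<Longrightarrow> b \<in> carrier Q \<Longrightarrow> c \<in> carrier Q
          \<Longrightarrow> (a \<lhd>\<^sub>q b) \<lhd>\<^sub>q c = (a \<lhd>\<^sub>q c) \<lhd>\<^sub>q (b \<lhd>\<^sub>q c)"

definition As :: "('a, 'm) qdl_scheme \<Rightarrow> 'a word set monoid" where
  "As Q = presented_group (carrier Q)
     {([(a, True), (b, True)], [(b, True), (a \<lhd>\<^sub>q\<^bsub>Q\<^esub> b, True)]) | a b.
        a \<in> carrier Q \<and> b \<in> carrier Q}"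

definition Conj :: "('a, 'm) monoid_scheme \<Rightarrow> 'a qdl" where
  "Conj G = \<lparr>carrier = carrier G, qop = (\<lambda>a b. inv\<^bsub>G\<^esub> b \<otimes>\<^bsub>G\<^esub> a \<otimes>\<^bsub>G\<^esub> b)\<rparr>"

definition A_group :: "('a, 'm) monoid_scheme \<Rightarrow> 'a word set monoid" where
  "A_group G = As (Conj G)"


section \<open>Conjugacy classes and Dehn quandles\<close>

definition conj_class :: "('a, 'm) monoid_scheme \<Rightarrow> 'a \<Rightarrow> 'a set" where
  "conj_class G a = {inv\<^bsub>G\<^esub> g \<otimes>\<^bsub>G\<^esub> a \<otimes>\<^bsub>G\<^esub> g | g. g \<in> carrier G}"

definition conj_classes :: "('a, 'm) monoid_scheme \<Rightarrow> 'a set set" where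
  "conj_classes G = conj_class G ` carrier G"

definition Dehn_quandle :: "('a, 'm) monoid_scheme \<Rightarrow> 'a set \<Rightarrow> 'a qdl" where
  "Dehn_quandle G \<Gamma> = (Conj G)\<lparr>carrier := (\<Union>a\<in>\<Gamma>. conj_class G a)\<rparr>"

definition Dehn_group :: "('a, 'm) monoid_scheme \<Rightarrow> 'a set \<Rightarrow> 'a word set monoid" where
  "Dehn_group G \<Gamma> = As (Dehn_quandle G \<Gamma>)"

definition nongen_classes :: "('a, 'm) monoid_scheme \<Rightarrow> 'a set \<Rightarrow> 'a set set" where
  "nongen_classes G \<Gamma> = {C \<in> conj_classes G. C \<inter> \<Gamma> = {}}"

lemma (in group) conj_class_closed: "a \<in> carrier G \<Longrightarrow> conj_class G a \<subseteq> carrier G"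
  by (auto simp: conj_class_def)

lemma (in group) conj_class_conj:
  assumes "a \<in> carrier G" "x \<in> conj_class G a" "b \<in> carrier G"
  shows "inv b \<otimes> x \<otimes> b \<in> conj_class G a"
proof -
  from assms obtain g where g: "g \<in> carrier G" "x = inv g \<otimes> a \<otimes> g"
    by (auto simp: conj_class_def)
  with assms have "inv b \<otimes> x \<otimes> b = inv (g \<otimes> b) \<otimes> a \<otimes> (g \<otimes> b)"
    by (simp add: inv_mult_group m_assoc)
  with assms g show ?thesis unfolding conj_class_def by blast
qed

lemma (in group) quandle_Dehn_quandle:
  assumes \<Gamma>: "\<Gamma> \<subseteq> carrier G"
  shows "quandle (Dehn_quandle G \<Gamma>)"
proof -
  define D where "D = (\<Union>a\<in>\<Gamma>. conj_class G a)"
  have D: "x \<in> carrier G" if "x \<in> D" for x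
    using that \<Gamma> conj_class_closed by (auto simp: D_def)
  have cl: "inv b \<otimes> x \<otimes> b \<in> D" if "x \<in> D" "b \<in> carrier G" for x b
    using that \<Gamma> conj_class_conj unfolding D_def by blast
  have c1: "inv b \<otimes> (b \<otimes> x \<otimes> inv b) \<otimes> b = x" "b \<otimes> (inv b \<otimes> x \<otimes> b) \<otimes> inv b = x"
    if "b \<in> carrier G" "x \<in> carrier G" for b x
  proof -
    have k: "b \<otimes> (inv b \<otimes> z) = z" "inv b \<otimes> (b \<otimes> z) = z" if "z \<in> carrier G" for z
      using that \<open>b \<in> carrier G\<close> by (simp_all flip: m_assoc)
    show "inv b \<otimes> (b \<otimes> x \<otimes> inv b) \<otimes> b = x" "b \<otimes> (inv b \<otimes> x \<otimes> b) \<otimes> inv b = x"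
      using that by (simp_all add: m_assoc k)
  qed
  have sd: "inv c \<otimes> (inv b \<otimes> a \<otimes> b) \<otimes> c
      = inv (inv c \<otimes> b \<otimes> c) \<otimes> (inv c \<otimes> a \<otimes> c) \<otimes> (inv c \<otimes> b \<otimes> c)"
    if "a \<in> carrier G" "b \<in> carrier G" "c \<in> carrier G" for a b c
  proof -
    have k: "c \<otimes> (inv c \<otimes> z) = z" if "z \<in> carrier G" for z
      using that \<open>c \<in> carrier G\<close> by (simp flip: m_assoc)
    show ?thesis using that by (simp add: inv_mult_group m_assoc k)
  qed
  show ?thesis
    unfolding quandle_def Dehn_quandle_def Conj_def
    apply (simp flip: D_def)
    apply (intro conjI allI impI)
    subgoal by (simp add: cl D)
    subgoal by (simp add: D)
    subgoal for b
    proof (rule bij_betw_byWitness[where f' = "\<lambda>a. b \<otimes> a \<otimes> inv b"])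
      assume "b \<in> D"
      then have b: "b \<in> carrier G" by (rule D)
      show "(\<lambda>a. b \<otimes> a \<otimes> inv b) ` D \<subseteq> D"
        using cl[of _ "inv b"] b by auto
    qed (use c1 cl D in auto)
    subgoal by (rule sd; rule D)
    done
qed

lemma (in group) Dehn_quandle_carrier: "Dehn_quandle G (carrier G) = Conj G"
proof -
  have "x \<in> conj_class G x" if "x \<in> carrier G" for x
    using that unfolding conj_class_def by (auto intro!: exI[of _ "\<one>"])
  then have "(\<Union>a\<in>carrier G. conj_class G a) = carrier G"
    using conj_class_closed by blast
  then show ?thesis by (simp add: Dehn_quandle_def Conj_def)
qed

lemma (in group) quandle_Conj: "quandle (Conj G)"
  using quandle_Dehn_quandle[of "carrier G"] by (simp add: Dehn_quandle_carrier)


section \<open>\<open>C\<close>-bar-type presentations\<close>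

definition conj_relation :: "'x \<Rightarrow> 'x \<Rightarrow> 'x \<Rightarrow> 'x word \<times> 'x word" where
  "conj_relation a b c = ([(b, False), (a, True), (b, True)], [(c, True)])"

definition power_relation :: "'x \<Rightarrow> nat \<Rightarrow> 'x word \<times> 'x word" where
  "power_relation a k = (replicate k (a, True), [])"

definition Cbar_presentation ::
  "('a, 'm) monoid_scheme \<Rightarrow> 'x set \<Rightarrow> ('x word \<times> 'x word) set \<Rightarrow> ('x \<Rightarrow> 'a) \<Rightarrow> bool" where
  "Cbar_presentation G X R \<iota> \<longleftrightarrow>
     is_presentation G X R \<iota> \<and>
     (\<forall>r\<in>R. (\<exists>a\<in>X. \<exists>b\<in>X. \<exists>c\<in>X. r = conj_relation a b c) \<or>
            (\<exists>a\<in>X. \<exists>k\<ge>2. r = power_relation a k)) \<and>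
     (\<forall>C\<in>conj_classes G. \<forall>a a' k k'.
        power_relation a k \<in> R \<and> \<iota> a \<in> C \<and> power_relation a' k' \<in> R \<and> \<iota> a' \<in> C
        \<longrightarrow> a = a' \<and> k = k')"

end

theory Submission
  imports Defs
begin

text \<open>
  Let \<open>D = As(\<Gamma>\<^sup>G)\<close> with generators \<open>d\<^sub>a\<close>, and \<open>proj: D \<rightarrow> G\<close>, \<open>d\<^sub>a \<mapsto> a\<close>. Conjugation by
  \<open>w \<in> D\<close> acts on the generators as conjugation by \<open>proj(w)\<close> acts on \<open>\<Gamma>\<^sup>G\<close>, so the kernel of
  \<open>proj\<close> is central. The conjugation relations already hold in \<open>D\<close>, so the kernel is generated
  by the powers \<open>d\<^sub>a\<^sup>k\<close> coming from the power relations. As there is at most one of these per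
  conjugacy class, the homomorphism from \<open>D\<close> to the free abelian group on the classes, counting
  the generators in each class, is injective on the kernel. Hence \<open>proj\<close> is injective on each
  conjugacy class of \<open>D\<close>, and so has a conjugation-equivariant section \<open>\<sigma>\<close> with \<open>\<sigma>(a) = d\<^sub>a\<close> on
  \<open>\<Gamma>\<^sup>G\<close>. In \<open>A(G)\<close>, where \<open>D\<close> maps by \<open>d\<^sub>a \<mapsto> e\<^sub>a\<close>, the defect \<open>e\<^sub>a \<sigma>(a)\<^sup>-\<^sup>1\<close> is central, depends
  only on the class of \<open>a\<close>, and is trivial on \<open>\<Gamma>\<^sup>G\<close>; the classes without generators contribute
  the free abelian factor in this way.
\<close>


section \<open>Conjugation\<close>

definition conjugate :: "('a, 'm) monoid_scheme \<Rightarrow> 'a \<Rightarrow> 'a \<Rightarrow> 'a" (infixl \<open>\<triangleleft>\<index>\<close> 75) where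
  "a \<triangleleft>\<^bsub>G\<^esub> g = inv\<^bsub>G\<^esub> g \<otimes>\<^bsub>G\<^esub> a \<otimes>\<^bsub>G\<^esub> g"

context group
begin

lemma conjugate_closed [simp]: "a \<in> carrier G \<Longrightarrow> g \<in> carrier G \<Longrightarrow> a \<triangleleft> g \<in> carrier G"
  by (simp add: conjugate_def)

lemma conjugate_one [simp]: "a \<in> carrier G \<Longrightarrow> a \<triangleleft> \<one> = a"
  by (simp add: conjugate_def)

lemma conjugate_by_mult:
  "a \<in> carrier G \<Longrightarrow> g \<in> carrier G \<Longrightarrow> h \<in> carrier G \<Longrightarrow> a \<triangleleft> (g \<otimes> h) = a \<triangleleft> g \<triangleleft> h"
  by (simp add: conjugate_def inv_mult_group m_assoc)

lemma conjugate_inv_cancel [simp]: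
  assumes "a \<in> carrier G" "g \<in> carrier G"
  shows "a \<triangleleft> g \<triangleleft> inv g = a" "a \<triangleleft> inv g \<triangleleft> g = a"
  using assms by (simp_all flip: conjugate_by_mult)

lemma conjugate_eq_iff:
  "a \<in> carrier G \<Longrightarrow> b \<in> carrier G \<Longrightarrow> g \<in> carrier G \<Longrightarrow> a \<triangleleft> g = b \<longleftrightarrow> a \<otimes> g = g \<otimes> b"
  by (simp add: conjugate_def m_assoc) (metis inv_solve_left m_closed)

lemma mult_conjugate:
  assumes "a \<in> carrier G" "b \<in> carrier G" "g \<in> carrier G"
  shows "(a \<otimes> b) \<triangleleft> g = a \<triangleleft> g \<otimes> b \<triangleleft> g"
proof -
  have "g \<otimes> (inv g \<otimes> (b \<otimes> g)) = b \<otimes> g" using assms by (simp flip: m_assoc)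
  then show ?thesis using assms by (simp add: conjugate_def m_assoc)
qed

lemma inv_conjugate: "a \<in> carrier G \<Longrightarrow> g \<in> carrier G \<Longrightarrow> inv a \<triangleleft> g = inv (a \<triangleleft> g)"
  by (simp add: conjugate_def inv_mult_group m_assoc)

lemma conj_class_eq_image_conjugate: "conj_class G a = (\<lambda>g. a \<triangleleft> g) ` carrier G"
  by (auto simp: conj_class_def conjugate_def)

lemma conjugate_in_conj_class: "g \<in> carrier G \<Longrightarrow> a \<triangleleft> g \<in> conj_class G a"
  by (simp add: conj_class_eq_image_conjugate)

lemma conj_class_self: "a \<in> carrier G \<Longrightarrow> a \<in> conj_class G a"
  using conjugate_in_conj_class[OF one_closed, of a] by simp

lemma conj_class_conjugate [simp]:
  assumes "a \<in> carrier G" "g \<in> carrier G"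
  shows "conj_class G (a \<triangleleft> g) = conj_class G a"
proof -
  have sub: "conj_class G (b \<triangleleft> h) \<subseteq> conj_class G b" if "b \<in> carrier G" "h \<in> carrier G" for b h
  proof
    fix c assume "c \<in> conj_class G (b \<triangleleft> h)"
    then obtain g where "g \<in> carrier G" "c = b \<triangleleft> h \<triangleleft> g"
      by (auto simp: conj_class_eq_image_conjugate)
    with that show "c \<in> conj_class G b"
      using conjugate_in_conj_class[of "h \<otimes> g" b] by (simp add: conjugate_by_mult)
  qed
  from sub[OF assms] sub[of "a \<triangleleft> g" "inv g"] assms show ?thesis by auto
qed

lemma conj_class_eq_iff:
  assumes "a \<in> carrier G" "b \<in> carrier G"
  shows "conj_class G b = conj_class G a \<longleftrightarrow> b \<in> conj_class G a"
  using assms conj_class_self[of b] conj_class_conjugate[of a]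
  by (auto simp: conj_class_eq_image_conjugate[of a])

end

lemma (in comm_group) conjugate_eq_self [simp]:
  "a \<in> carrier G \<Longrightarrow> g \<in> carrier G \<Longrightarrow> a \<triangleleft> g = a"
  by (simp add: conjugate_eq_iff m_comm)

lemma (in group_hom) hom_conjugate [simp]: "a \<in> carrier G \<Longrightarrow> g \<in> carrier G \<Longrightarrow> h (a \<triangleleft> g) = h a \<triangleleft>\<^bsub>H\<^esub> h g"
  by (simp add: conjugate_def)

section \<open>Centralizers and generating sets\<close>

definition centralizer :: "('a, 'm) monoid_scheme \<Rightarrow> 'a set \<Rightarrow> 'a set" where
  "centralizer G A = {x \<in> carrier G. \<forall>a\<in>A. x \<otimes>\<^bsub>G\<^esub> a = a \<otimes>\<^bsub>G\<^esub> x}"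

abbreviation center :: "('a, 'm) monoid_scheme \<Rightarrow> 'a set" where
  "center G \<equiv> centralizer G (carrier G)"

lemma centralizer_closed: "x \<in> centralizer G A \<Longrightarrow> x \<in> carrier G"
  by (simp add: centralizer_def)

lemma center_commute: "z \<in> center G \<Longrightarrow> x \<in> carrier G \<Longrightarrow> z \<otimes>\<^bsub>G\<^esub> x = x \<otimes>\<^bsub>G\<^esub> z"
  by (simp add: centralizer_def)

lemma (in group) in_centralizer_iff_conjugate:
  "A \<subseteq> carrier G \<Longrightarrow> x \<in> centralizer G A \<longleftrightarrow> x \<in> carrier G \<and> (\<forall>a\<in>A. a \<triangleleft> x = a)"
  by (auto simp: centralizer_def conjugate_eq_iff subset_iff)

lemma (in group) subgroup_centralizer:
  assumes "A \<subseteq> carrier G"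
  shows "subgroup (centralizer G A) G"
proof (rule subgroupI)
  have "\<one> \<in> centralizer G A" using assms by (auto simp: in_centralizer_iff_conjugate)
  then show "centralizer G A \<noteq> {}" by blast
  show "inv x \<in> centralizer G A" if "x \<in> centralizer G A" for x
    using assms that
    by (simp add: in_centralizer_iff_conjugate) (metis conjugate_inv_cancel(1) subsetD)
  show "x \<otimes> y \<in> centralizer G A" if "x \<in> centralizer G A" "y \<in> centralizer G A" for x y
    using assms that by (auto simp: in_centralizer_iff_conjugate conjugate_by_mult subset_iff)
qed (auto intro: centralizer_closed)

lemma (in group) centralizer_generate:
  assumes "A \<subseteq> carrier G"
  shows "centralizer G (generate G A) = centralizer G A"
proof (intro equalityI subsetI)
  fix x assume x: "x \<in> centralizer G A"
  then have "generate G A \<subseteq> centralizer G {x}"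
    using assms by (intro generate_subgroup_incl subgroup_centralizer) (auto simp: centralizer_def)
  with x show "x \<in> centralizer G (generate G A)" by (auto simp: centralizer_def)
qed (auto simp: centralizer_def intro: generate.incl)

lemma (in group) comm_group_center: "comm_group (G\<lparr>carrier := center G\<rparr>)"
proof (rule group.group_comm_groupI)
  show "group (G\<lparr>carrier := center G\<rparr>)"
    by (rule subgroup_imp_group[OF subgroup_centralizer[OF order_refl]])
  fix x y assume "x \<in> carrier (G\<lparr>carrier := center G\<rparr>)" "y \<in> carrier (G\<lparr>carrier := center G\<rparr>)"
  then have "x \<in> center G" "y \<in> carrier G" by (auto intro: centralizer_closed)
  from center_commute[OF this] show "x \<otimes>\<^bsub>G\<lparr>carrier := center G\<rparr>\<^esub> y = y \<otimes>\<^bsub>G\<lparr>carrier := center G\<rparr>\<^esub> x"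
    by simp
qed

lemma (in group) conjugate_center: "z \<in> center G \<Longrightarrow> g \<in> carrier G \<Longrightarrow> z \<triangleleft> g = z"
  by (simp add: conjugate_eq_iff centralizer_def)

lemma (in group) subgroup_of_center_normal:
  assumes "subgroup N G" "N \<subseteq> center G"
  shows "N \<lhd> G"
proof (rule normal_invI[OF assms(1)])
  fix g z assume "g \<in> carrier G" "z \<in> N"
  moreover from this have "z \<otimes> g = g \<otimes> z" "z \<in> carrier G"
    using assms(2) by (auto simp: centralizer_def)
  ultimately show "g \<otimes> z \<otimes> inv g \<in> N" by (metis inv_solve_right' m_closed)
qed

lemma group_hom_compose: "group_hom G H g \<Longrightarrow> group_hom H K h \<Longrightarrow> group_hom G K (h \<circ> g)"
  by (auto simp: group_hom_def group_hom_axioms_def intro: Group.hom_compose)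

lemma hom_eq_on_generate:
  assumes "group_hom G H g" "group_hom G H h" "A \<subseteq> carrier G"
    and "\<And>a. a \<in> A \<Longrightarrow> g a = h a" and "x \<in> generate G A"
  shows "g x = h x"
proof -
  interpret g: group_hom G H g by fact
  interpret h: group_hom G H h by fact
  show ?thesis
    using assms(5)
  proof induction
    case (eng x y)
    then show ?case using g.G.generate_in_carrier[OF assms(3)] by simp
  qed (use assms(3,4) in auto)
qed

lemma (in group) hom_DirProd_commuting:
  assumes "f \<in> hom H G" "g \<in> hom K G"
    and "\<And>x y. x \<in> carrier H \<Longrightarrow> y \<in> carrier K \<Longrightarrow> f x \<otimes> g y = g y \<otimes> f x"
  shows "(\<lambda>(x, y). f x \<otimes> g y) \<in> hom (H \<times>\<times> K) G"
proof (rule homI)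
  fix p q assume "p \<in> carrier (H \<times>\<times> K)" "q \<in> carrier (H \<times>\<times> K)"
  then obtain x y x' y' where pq: "p = (x, y)" "q = (x', y')"
    and H: "x \<in> carrier H" "x' \<in> carrier H" and K: "y \<in> carrier K" "y' \<in> carrier K"
    by auto
  note closed = H[THEN hom_in_carrier[OF assms(1)]] K[THEN hom_in_carrier[OF assms(2)]]
  have "f (x \<otimes>\<^bsub>H\<^esub> x') \<otimes> g (y \<otimes>\<^bsub>K\<^esub> y') = f x \<otimes> (f x' \<otimes> g y) \<otimes> g y'"
    using closed by (simp add: hom_mult[OF assms(1) H] hom_mult[OF assms(2) K] m_assoc)
  also have "\<dots> = f x \<otimes> g y \<otimes> (f x' \<otimes> g y')"
    using closed by (simp add: assms(3)[OF H(2) K(1)] m_assoc)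
  finally show "(case p \<otimes>\<^bsub>H \<times>\<times> K\<^esub> q of (x, y) \<Rightarrow> f x \<otimes> g y)
      = (case p of (x, y) \<Rightarrow> f x \<otimes> g y) \<otimes> (case q of (x, y) \<Rightarrow> f x \<otimes> g y)"
    by (simp add: pq)
qed (use assms in \<open>auto simp: hom_in_carrier\<close>)


section \<open>Free abelian groups\<close>

lemma generate_free_Abelian_group:
  "generate (free_Abelian_group I) (frag_of ` I) = carrier (free_Abelian_group I)"
proof (intro equalityI subsetI)
  let ?F = "free_Abelian_group I"
  interpret F: group ?F by simp
  have gens: "frag_of ` I \<subseteq> carrier ?F" by auto
  show "c \<in> carrier ?F" if "c \<in> generate ?F (frag_of ` I)" for c
    using F.generate_in_carrier[OF gens that] .
  show "c \<in> generate ?F (frag_of ` I)" if "c \<in> carrier ?F" for c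
  proof -
    from that have "Poly_Mapping.keys c \<subseteq> I" by simp
    then show ?thesis
    proof (induction rule: free_Abelian_group_induct[consumes 1, case_names zero diff gen])
      case zero
      show ?case using generate.one[of ?F] by simp
    next
      case (diff x y)
      then have "x \<otimes>\<^bsub>?F\<^esub> inv\<^bsub>?F\<^esub> y \<in> generate ?F (frag_of ` I)"
        using gens by (intro generate.eng F.generate_m_inv_closed)
      with diff show ?case by simp
    qed (simp add: generate.incl)
  qed
qed

lemma hom_eq_on_free_Abelian_group:
  assumes "group_hom (free_Abelian_group I) H g" "group_hom (free_Abelian_group I) H h"
    and "\<And>i. i \<in> I \<Longrightarrow> g (frag_of i) = h (frag_of i)" and "c \<in> carrier (free_Abelian_group I)"
  shows "g c = h c"
  by (rule hom_eq_on_generate[OF assms(1,2), of "frag_of ` I"])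
    (use assms(3,4) in \<open>auto simp: generate_free_Abelian_group\<close>)

lemma (in group) free_Abelian_group_universal_center:
  assumes "f ` I \<subseteq> center G"
  obtains h where "group_hom (free_Abelian_group I) G h" "\<And>i. i \<in> I \<Longrightarrow> h (frag_of i) = f i"
    "h ` carrier (free_Abelian_group I) \<subseteq> center G"
proof -
  let ?Z = "G\<lparr>carrier := center G\<rparr>"
  interpret Z: comm_group ?Z by (rule comm_group_center)
  obtain h where h: "h \<in> hom (free_Abelian_group I) ?Z" "\<And>i. i \<in> I \<Longrightarrow> h (frag_of i) = f i"
    using Z.free_Abelian_group_universal[of f I] assms by auto
  have center: "h ` carrier (free_Abelian_group I) \<subseteq> center G" using hom_carrier[OF h(1)] by simp
  moreover have "h \<in> hom (free_Abelian_group I) G"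
    using h(1) by (auto simp: hom_def intro: centralizer_closed)
  then have "group_hom (free_Abelian_group I) G h"
    by (simp add: group_hom_def group_hom_axioms_def is_group)
  ultimately show thesis using h(2) that by blast
qed

lemma group_hom_lookup:
  "group_hom (free_Abelian_group I) integer_group (\<lambda>c. Poly_Mapping.lookup c i)"
  by (simp add: group_hom_def group_hom_axioms_def hom_def lookup_add)

lemma inj_on_hom_free_Abelian_group:
  assumes h: "group_hom (free_Abelian_group I) (free_Abelian_group J) h"
    and h_gen: "\<And>i. i \<in> I \<Longrightarrow> h (frag_of i) = frag_cmul (k i) (frag_of (p i))"
    and p: "inj_on p I" and k: "\<And>i. i \<in> I \<Longrightarrow> k i \<noteq> 0"
  shows "inj_on h (carrier (free_Abelian_group I))"
proof (rule inj_onI)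
  have lookup_h: "Poly_Mapping.lookup (h c) (p i) = k i * Poly_Mapping.lookup c i"
    if "i \<in> I" "c \<in> carrier (free_Abelian_group I)" for c i
  proof (rule hom_eq_on_free_Abelian_group[OF _ _ _ that(2)])
    show "group_hom (free_Abelian_group I) integer_group (\<lambda>c. Poly_Mapping.lookup (h c) (p i))"
      using group_hom_compose[OF h group_hom_lookup] by (simp add: o_def)
    show "group_hom (free_Abelian_group I) integer_group (\<lambda>c. k i * Poly_Mapping.lookup c i)"
      by (simp add: group_hom_def group_hom_axioms_def hom_def lookup_add algebra_simps)
    show "Poly_Mapping.lookup (h (frag_of j)) (p i) = k i * Poly_Mapping.lookup (frag_of j) i"
      if "j \<in> I" for j
      using p that \<open>i \<in> I\<close> by (auto simp: h_gen inj_on_eq_iff)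
  qed
  fix c c' assume c: "c \<in> carrier (free_Abelian_group I)" "c' \<in> carrier (free_Abelian_group I)"
    and eq: "h c = h c'"
  show "c = c'"
  proof (rule poly_mapping_eqI)
    fix i
    show "Poly_Mapping.lookup c i = Poly_Mapping.lookup c' i"
    proof (cases "i \<in> I")
      case True
      then show ?thesis using lookup_h[OF True c(1)] lookup_h[OF True c(2)] eq k by simp
    next
      case False
      then have "i \<notin> Poly_Mapping.keys c" "i \<notin> Poly_Mapping.keys c'" using c by auto
      then show ?thesis by (simp add: in_keys_iff)
    qed
  qed
qed


section \<open>Equivariant sections\<close>

context group_hom
begin

text \<open>A homomorphism to an abelian group is constant on conjugacy classes.\<close>

lemma inj_on_conj_class_if_separated:
  assumes "comm_group K" "n \<in> hom G K"
    and separated: "\<And>x. x \<in> carrier G \<Longrightarrow> h x = \<one>\<^bsub>H\<^esub> \<Longrightarrow> n x = \<one>\<^bsub>K\<^esub> \<Longrightarrow> x = \<one>"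
    and "x \<in> carrier G"
  shows "inj_on h (conj_class G x)"
proof (rule inj_onI)
  interpret K: comm_group K by fact
  interpret n: group_hom G K n using assms(2) by unfold_locales
  fix y z assume "y \<in> conj_class G x" "z \<in> conj_class G x" and h: "h y = h z"
  then have yz: "y \<in> carrier G" "z \<in> carrier G" and n: "n y = n z"
    using assms(4) by (auto simp: G.conj_class_eq_image_conjugate)
  have "y \<otimes> inv z = \<one>" using yz h n by (intro separated) simp_all
  then show "y = z" using yz G.inv_solve_right'[of \<one> y z] by simp
qed

lemma image_conj_class:
  assumes "h ` carrier G = carrier H" "x \<in> carrier G"
  shows "h ` conj_class G x = conj_class H (h x)"
proof -
  have "h ` conj_class G x = (\<lambda>w. h x \<triangleleft>\<^bsub>H\<^esub> h w) ` carrier G"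
    using assms(2) by (simp add: G.conj_class_eq_image_conjugate image_image)
  also have "\<dots> = (\<lambda>g. h x \<triangleleft>\<^bsub>H\<^esub> g) ` h ` carrier G" by (simp only: image_image)
  also have "\<dots> = conj_class H (h x)" by (simp only: assms(1) H.conj_class_eq_image_conjugate)
  finally show ?thesis .
qed

lemma equivariant_section:
  assumes surj: "h ` carrier G = carrier H"
    and inj: "\<And>x. x \<in> carrier G \<Longrightarrow> inj_on h (conj_class G x)"
  obtains \<sigma> where "\<And>y. y \<in> carrier H \<Longrightarrow> \<sigma> y \<in> carrier G" "\<And>y. y \<in> carrier H \<Longrightarrow> h (\<sigma> y) = y"
    "\<And>y w. y \<in> carrier H \<Longrightarrow> w \<in> carrier G \<Longrightarrow> \<sigma> (y \<triangleleft>\<^bsub>H\<^esub> h w) = \<sigma> y \<triangleleft> w"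
proof -
  define lift where "lift C = (SOME x. x \<in> carrier G \<and> h ` conj_class G x = C)" for C
  have lift: "lift (conj_class H y) \<in> carrier G"
    "h ` conj_class G (lift (conj_class H y)) = conj_class H y"
    if "y \<in> carrier H" for y
  proof -
    have "y \<in> h ` carrier G" using that by (simp only: surj)
    then have "\<exists>x. x \<in> carrier G \<and> h ` conj_class G x = conj_class H y"
      using image_conj_class[OF surj] by blast
    from someI_ex[OF this]
    show "lift (conj_class H y) \<in> carrier G"
      "h ` conj_class G (lift (conj_class H y)) = conj_class H y"
      by (simp_all add: lift_def)
  qed
  define \<sigma> where "\<sigma> y = inv_into (conj_class G (lift (conj_class H y))) h y" for y
  have \<sigma>_mem: "\<sigma> y \<in> conj_class G (lift (conj_class H y))" and h_\<sigma>: "h (\<sigma> y) = y"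
    if "y \<in> carrier H" for y
    using lift(2)[OF that] H.conj_class_self[OF that]
    by (simp_all add: \<sigma>_def inv_into_into f_inv_into_f)
  have \<sigma>_closed: "\<sigma> y \<in> carrier G" if "y \<in> carrier H" for y
    using \<sigma>_mem[OF that] lift(1)[OF that] G.conj_class_closed by blast
  have "\<sigma> (y \<triangleleft>\<^bsub>H\<^esub> h w) = \<sigma> y \<triangleleft> w" if y: "y \<in> carrier H" and w: "w \<in> carrier G" for y w
  proof (rule inj_onD[OF inj[OF lift(1)[OF y]]])
    show "\<sigma> (y \<triangleleft>\<^bsub>H\<^esub> h w) \<in> conj_class G (lift (conj_class H y))"
      using \<sigma>_mem[of "y \<triangleleft>\<^bsub>H\<^esub> h w"] y w by simp
    show "\<sigma> y \<triangleleft> w \<in> conj_class G (lift (conj_class H y))"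
      using G.conj_class_conj[OF lift(1) \<sigma>_mem] y w by (simp add: conjugate_def)
  qed (use y w h_\<sigma> \<sigma>_closed in simp)
  with \<sigma>_closed h_\<sigma> show thesis by (rule that)
qed

end


section \<open>Group presentations\<close>

lemma (in group) eval_word_generate:
  "u \<in> words X \<Longrightarrow> eval_word G f u \<in> generate G (f ` X)"
  by (induction u) (auto intro: generate.intros)

lemma (in group) eval_word_closed:
  "f \<in> X \<rightarrow> carrier G \<Longrightarrow> u \<in> words X \<Longrightarrow> eval_word G f u \<in> carrier G"
  using generate_in_carrier[OF _ eval_word_generate, of f X u] by auto

lemma (in group) eval_word_replicate:
  "f a \<in> carrier G \<Longrightarrow> eval_word G f (replicate k (a, True)) = f a [^] k"
  by (induction k) (auto simp flip: nat_pow_Suc2)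

lemma (in group_hom) hom_eval_word:
  "f \<in> X \<rightarrow> carrier G \<Longrightarrow> u \<in> words X \<Longrightarrow> h (eval_word G f u) = eval_word H (h \<circ> f) u"
  by (induction u) (auto simp: Pi_iff G.eval_word_closed)

lemma eval_word_cong: "u \<in> words X \<Longrightarrow> (\<And>x. x \<in> X \<Longrightarrow> f x = g x) \<Longrightarrow> eval_word G f u = eval_word G g u"
  by (induction u) auto

abbreviation presented_gen :: "'x set \<Rightarrow> ('x word \<times> 'x word) set \<Rightarrow> 'x \<Rightarrow> 'x word set" where
  "presented_gen X R x \<equiv> word_class X R [(x, True)]"

lemma word_class_closed: "u \<in> words X \<Longrightarrow> word_class X R u \<in> carrier (presented_group X R)"
  by (simp add: presented_group_def)

lemma carrier_presented_groupE:
  assumes "c \<in> carrier (presented_group X R)"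
  obtains u where "u \<in> words X" "c = word_class X R u"
  using assms by (auto simp: presented_group_def)

lemma one_presented_group: "\<one>\<^bsub>presented_group X R\<^esub> = word_class X R []"
  by (simp add: presented_group_def)

lemma inv_presented_gen:
  assumes "x \<in> X"
  shows "inv\<^bsub>presented_group X R\<^esub> presented_gen X R x = word_class X R [(x, False)]"
proof -
  interpret group "presented_group X R" by (rule group_presented_group)
  have "word_class X R [(x, False), (x, True)] = word_class X R []"
    using word_eq.cancel[OF assms, of R False] by (simp add: word_class_eq_iff)
  then show ?thesis
    using assms by (intro inv_equality word_class_closed)
      (simp_all add: presented_group_mult one_presented_group)
qed

lemma eval_word_presented_group:
  "u \<in> words X \<Longrightarrow> eval_word (presented_group X R) (presented_gen X R) u = word_class X R u"
proof (induction u)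
  case (Cons p u)
  obtain x b where p: "p = (x, b)" by (cases p)
  with Cons show ?case
    using presented_group_mult[of "[(x, b)]" X u R]
    by (cases b) (simp_all add: inv_presented_gen)
qed (simp add: one_presented_group)

lemma generate_presented_group:
  "generate (presented_group X R) (presented_gen X R ` X) = carrier (presented_group X R)"
proof -
  interpret group "presented_group X R" by (rule group_presented_group)
  show ?thesis
  proof (intro equalityI generate_incl subsetI)
    fix c assume "c \<in> carrier (presented_group X R)"
    then obtain u where "u \<in> words X" "c = word_class X R u" by (rule carrier_presented_groupE)
    then show "c \<in> generate (presented_group X R) (presented_gen X R ` X)"
      using eval_word_generate[of u X "presented_gen X R"]
      by (simp add: eval_word_presented_group)
  qed (auto intro: word_class_closed)
qed

lemma is_presentation_iso:
  assumes "group G" "is_presentation G X R \<iota>"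
  obtains \<phi> where "\<phi> \<in> iso (presented_group X R) G"
    "\<And>u. u \<in> words X \<Longrightarrow> \<phi> (word_class X R u) = eval_word G \<iota> u"
proof -
  obtain \<phi> where \<phi>: "\<phi> \<in> iso (presented_group X R) G" "\<And>x. x \<in> X \<Longrightarrow> \<phi> (presented_gen X R x) = \<iota> x"
    using assms(2) by (auto simp: is_presentation_def)
  interpret group_hom "presented_group X R" G \<phi>
    using assms(1) iso_imp_homomorphism[OF \<phi>(1)]
    by (simp add: group_hom_def group_hom_axioms_def group_presented_group)
  have "\<phi> (word_class X R u) = eval_word G \<iota> u" if "u \<in> words X" for u
  proof -
    have "\<phi> (word_class X R u) = eval_word G (\<phi> \<circ> presented_gen X R) u"
      using hom_eval_word[of "presented_gen X R" X u] that
      by (simp add: eval_word_presented_group word_class_closed)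
    also have "\<dots> = eval_word G \<iota> u" using that by (rule eval_word_cong) (simp add: \<phi>(2))
    finally show ?thesis .
  qed
  with \<phi>(1) show thesis by (rule that)
qed

lemma is_presentation_closed:
  assumes "group G" "is_presentation G X R \<iota>" "x \<in> X"
  shows "\<iota> x \<in> carrier G"
proof -
  obtain \<phi> where "\<phi> \<in> iso (presented_group X R) G" "\<forall>x\<in>X. \<phi> (presented_gen X R x) = \<iota> x"
    using assms(2) by (auto simp: is_presentation_def)
  with assms(3) show ?thesis
    using hom_in_carrier[OF iso_imp_homomorphism word_class_closed, of \<phi> X R G "[(x, True)]"]
    by simp
qed

lemma is_presentation_rel:
  assumes "group G" "is_presentation G X R \<iota>" "(l, r) \<in> R"
  shows "eval_word G \<iota> l = eval_word G \<iota> r"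
proof -
  obtain \<phi> where \<phi>: "\<And>u. u \<in> words X \<Longrightarrow> \<phi> (word_class X R u) = eval_word G \<iota> u"
    by (rule is_presentation_iso[OF assms(1,2)]) blast
  have "l \<in> words X" "r \<in> words X" using assms(2,3) by (auto simp: is_presentation_def)
  moreover from this have "word_class X R l = word_class X R r"
    using assms(3) by (simp add: word_class_eq_iff word_eq.rel)
  ultimately show ?thesis using \<phi> by metis
qed

lemma is_presentation_generate:
  assumes "group G" "is_presentation G X R \<iota>"
  shows "generate G (\<iota> ` X) = carrier G"
proof (intro equalityI subsetI)
  interpret group G by fact
  show "g \<in> carrier G" if "g \<in> generate G (\<iota> ` X)" for g
    using generate_in_carrier[OF _ that] is_presentation_closed[OF assms] by auto
  fix g assume g: "g \<in> carrier G"
  obtain \<phi> where \<phi>: "\<phi> \<in> iso (presented_group X R) G"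
    "\<And>u. u \<in> words X \<Longrightarrow> \<phi> (word_class X R u) = eval_word G \<iota> u"
    by (rule is_presentation_iso[OF assms]) blast
  from g \<phi>(1) have "g \<in> \<phi> ` carrier (presented_group X R)" by (simp add: iso_iff)
  then obtain u where "u \<in> words X" "g = eval_word G \<iota> u"
    using \<phi>(2) by (auto elim: carrier_presented_groupE)
  then show "g \<in> generate G (\<iota> ` X)" by (simp add: eval_word_generate)
qed

lemma is_presentation_universal:
  assumes "group G" "is_presentation G X R \<iota>" and "group K" "f \<in> X \<rightarrow> carrier K"
    and rel: "\<And>l r. (l, r) \<in> R \<Longrightarrow> eval_word K f l = eval_word K f r"
  obtains h where "h \<in> hom G K" "\<And>x. x \<in> X \<Longrightarrow> h (\<iota> x) = f x"
proof -
  interpret K: group K by fact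
  obtain \<phi> where \<phi>: "\<phi> \<in> iso (presented_group X R) G"
    "\<And>u. u \<in> words X \<Longrightarrow> \<phi> (word_class X R u) = eval_word G \<iota> u"
    by (rule is_presentation_iso[OF assms(1,2)]) blast
  let ?\<phi>' = "inv_into (carrier (presented_group X R)) \<phi>"
  obtain k where k: "k \<in> hom (presented_group X R) K"
    "\<And>u. u \<in> words X \<Longrightarrow> k (word_class X R u) = eval_word K f u"
    using presented_group_universal[OF assms(3,4), of R] rel by blast
  show thesis
  proof (rule that)
    have "?\<phi>' \<in> hom G (presented_group X R)"
      by (rule iso_imp_homomorphism[OF group.iso_set_sym[OF group_presented_group \<phi>(1)]])
    then show "k \<circ> ?\<phi>' \<in> hom G K" using k(1) by (rule Group.hom_compose)
    fix x assume x: "x \<in> X"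
    have "\<iota> x = \<phi> (presented_gen X R x)"
      using x \<phi>(2)[of "[(x, True)]"] is_presentation_closed[OF assms(1,2) x] assms(1)
      by (simp add: group.is_monoid monoid.r_one)
    moreover have "inj_on \<phi> (carrier (presented_group X R))" using \<phi>(1) by (simp add: iso_iff)
    ultimately have "?\<phi>' (\<iota> x) = presented_gen X R x"
      using x by (simp add: word_class_closed)
    then show "(k \<circ> ?\<phi>') (\<iota> x) = f x" using k(2)[of "[(x, True)]"] x assms(4) by (auto simp: Pi_iff)
  qed
qed


section \<open>Structure groups of quandles\<close>

definition As_relations :: "('a, 'm) qdl_scheme \<Rightarrow> ('a word \<times> 'a word) set" where
  "As_relations Q = {([(a, True), (b, True)], [(b, True), (a \<lhd>\<^sub>q\<^bsub>Q\<^esub> b, True)]) | a b.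
     a \<in> carrier Q \<and> b \<in> carrier Q}"

definition As_gen :: "('a, 'm) qdl_scheme \<Rightarrow> 'a \<Rightarrow> 'a word set" where
  "As_gen Q a = presented_gen (carrier Q) (As_relations Q) a"

definition As_lift ::
  "('a, 'm) qdl_scheme \<Rightarrow> ('b, 'n) monoid_scheme \<Rightarrow> ('a \<Rightarrow> 'b) \<Rightarrow> 'a word set \<Rightarrow> 'b" where
  "As_lift Q K f = (SOME h. h \<in> hom (As Q) K \<and> (\<forall>a\<in>carrier Q. h (As_gen Q a) = f a))"

lemma As_eq_presented_group: "As Q = presented_group (carrier Q) (As_relations Q)"
  by (simp add: As_def As_relations_def)

lemma group_As: "group (As Q)"
  by (simp add: As_eq_presented_group group_presented_group)

lemma As_gen_closed [simp]: "a \<in> carrier Q \<Longrightarrow> As_gen Q a \<in> carrier (As Q)"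
  by (simp add: As_gen_def As_eq_presented_group word_class_closed)

lemma generate_As_gen: "generate (As Q) (As_gen Q ` carrier Q) = carrier (As Q)"
  using generate_presented_group[of "carrier Q" "As_relations Q"]
  by (simp add: As_eq_presented_group As_gen_def[abs_def])

lemma hom_eq_on_As:
  assumes "group_hom (As Q) K g" "group_hom (As Q) K h"
    and "\<And>a. a \<in> carrier Q \<Longrightarrow> g (As_gen Q a) = h (As_gen Q a)" and "x \<in> carrier (As Q)"
  shows "g x = h x"
  by (rule hom_eq_on_generate[OF assms(1,2), of "As_gen Q ` carrier Q"])
    (use assms(3,4) in \<open>auto simp: generate_As_gen\<close>)

context quandle
begin

lemma As_gen_conjugate:
  assumes "a \<in> carrier Q" "b \<in> carrier Q"
  shows "As_gen Q a \<triangleleft>\<^bsub>As Q\<^esub> As_gen Q b = As_gen Q (a \<lhd>\<^sub>q b)"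
proof -
  interpret As: group "As Q" by (rule group_As)
  have "As_gen Q a \<otimes>\<^bsub>As Q\<^esub> As_gen Q b = As_gen Q b \<otimes>\<^bsub>As Q\<^esub> As_gen Q (a \<lhd>\<^sub>q b)"
    unfolding As_gen_def As_eq_presented_group using assms closed
    by (auto simp: presented_group_mult word_class_eq_iff As_relations_def intro!: word_eq.rel)
  with assms closed show ?thesis by (simp add: As.conjugate_eq_iff)
qed

lemma As_lift:
  assumes "group K" "f \<in> carrier Q \<rightarrow> carrier K"
    and conj: "\<And>a b. a \<in> carrier Q \<Longrightarrow> b \<in> carrier Q \<Longrightarrow> f a \<triangleleft>\<^bsub>K\<^esub> f b = f (a \<lhd>\<^sub>q b)"
  shows group_hom_As_lift: "group_hom (As Q) K (As_lift Q K f)"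
    and As_lift_gen: "a \<in> carrier Q \<Longrightarrow> As_lift Q K f (As_gen Q a) = f a"
proof -
  interpret K: group K by fact
  have f: "f a \<in> carrier K" if "a \<in> carrier Q" for a using assms(2) that by auto
  have "eval_word K f l = eval_word K f r" if "(l, r) \<in> As_relations Q" for l r
  proof -
    from that obtain a b where ab: "a \<in> carrier Q" "b \<in> carrier Q"
      and "l = [(a, True), (b, True)]" "r = [(b, True), (a \<lhd>\<^sub>q b, True)]"
      by (auto simp: As_relations_def)
    moreover have "f a \<otimes>\<^bsub>K\<^esub> f b = f b \<otimes>\<^bsub>K\<^esub> f (a \<lhd>\<^sub>q b)"
      using K.conjugate_eq_iff[of "f a" "f (a \<lhd>\<^sub>q b)" "f b"] conj[OF ab] ab f closed by simp
    ultimately show ?thesis using f[OF ab(1)] f[OF ab(2)] f[OF closed[OF ab]] by simp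
  qed
  then obtain h where "h \<in> hom (As Q) K"
    "\<And>u. u \<in> words (carrier Q) \<Longrightarrow> h (word_class (carrier Q) (As_relations Q) u) = eval_word K f u"
    using presented_group_universal[OF assms(1,2), of "As_relations Q"]
    by (auto simp: As_eq_presented_group)
  then have "\<exists>h. h \<in> hom (As Q) K \<and> (\<forall>a\<in>carrier Q. h (As_gen Q a) = f a)"
    using f by (intro exI[of _ h]) (simp add: As_gen_def)
  then have "As_lift Q K f \<in> hom (As Q) K \<and> (\<forall>a\<in>carrier Q. As_lift Q K f (As_gen Q a) = f a)"
    unfolding As_lift_def by (rule someI_ex)
  then show "group_hom (As Q) K (As_lift Q K f)"
    "a \<in> carrier Q \<Longrightarrow> As_lift Q K f (As_gen Q a) = f a"
    by (simp_all add: group_hom_def group_hom_axioms_def group_As assms(1))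
qed

end


section \<open>Structure groups of Dehn quandles\<close>

lemma carrier_Conj [simp]: "carrier (Conj G) = carrier G"
  by (simp add: Conj_def)

lemma carrier_Dehn_quandle: "carrier (Dehn_quandle G \<Gamma>) = (\<Union>a\<in>\<Gamma>. conj_class G a)"
  by (simp add: Dehn_quandle_def)

lemma qop_Dehn_quandle [simp]: "a \<lhd>\<^sub>q\<^bsub>Dehn_quandle G \<Gamma>\<^esub> b = a \<triangleleft>\<^bsub>G\<^esub> b"
  by (simp add: Dehn_quandle_def Conj_def conjugate_def)

locale dehn = group G for G (structure) +
  fixes \<Gamma> :: "'a set"
  assumes gens_closed: "\<Gamma> \<subseteq> carrier G"
begin

abbreviation S :: "'a set" where "S \<equiv> carrier (Dehn_quandle G \<Gamma>)"

abbreviation D :: "'a word set monoid" where "D \<equiv> As (Dehn_quandle G \<Gamma>)"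

abbreviation d :: "'a \<Rightarrow> 'a word set" where "d \<equiv> As_gen (Dehn_quandle G \<Gamma>)"

sublocale Q: quandle "Dehn_quandle G \<Gamma>"
  using gens_closed by (rule quandle_Dehn_quandle)

sublocale D: group D
  by (rule group_As)

lemma S_closed: "a \<in> S \<Longrightarrow> a \<in> carrier G"
  using gens_closed conj_class_closed by (auto simp: carrier_Dehn_quandle)

lemma gens_subset_S: "\<Gamma> \<subseteq> S"
  using gens_closed conj_class_self by (auto simp: carrier_Dehn_quandle)

lemma S_conjugate: "a \<in> S \<Longrightarrow> g \<in> carrier G \<Longrightarrow> a \<triangleleft> g \<in> S"
  using gens_closed conj_class_conj unfolding carrier_Dehn_quandle conjugate_def by blast

lemma S_conjugate_iff:
  assumes "a \<in> carrier G" "g \<in> carrier G"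
  shows "a \<triangleleft> g \<in> S \<longleftrightarrow> a \<in> S"
  using assms S_conjugate[of a g] S_conjugate[of "a \<triangleleft> g" "inv g"] by auto

lemma nongen_classes_eq: "nongen_classes G \<Gamma> = conj_class G ` (carrier G - S)"
proof -
  have "a \<in> S \<longleftrightarrow> conj_class G a \<inter> \<Gamma> \<noteq> {}" if a: "a \<in> carrier G" for a
  proof -
    have "a \<in> conj_class G b \<longleftrightarrow> b \<in> conj_class G a" if "b \<in> \<Gamma>" for b
      using a that gens_closed by (metis conj_class_eq_iff subsetD)
    then show ?thesis by (auto simp: carrier_Dehn_quandle)
  qed
  then show ?thesis by (auto simp: nongen_classes_def conj_classes_def)
qed

definition proj :: "'a word set \<Rightarrow> 'a" where
  "proj = As_lift (Dehn_quandle G \<Gamma>) G (\<lambda>a. a)"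

sublocale proj: group_hom D G proj
  unfolding proj_def by (rule Q.group_hom_As_lift) (simp_all add: is_group S_closed)

lemma proj_gen [simp]: "a \<in> S \<Longrightarrow> proj (d a) = a"
  unfolding proj_def by (rule Q.As_lift_gen) (simp_all add: is_group S_closed)

definition class_count :: "'a word set \<Rightarrow> 'a set \<Rightarrow>\<^sub>0 int" where
  "class_count = As_lift (Dehn_quandle G \<Gamma>) (free_Abelian_group (conj_classes G))
     (\<lambda>a. frag_of (conj_class G a))"

lemma
  shows group_hom_class_count: "group_hom D (free_Abelian_group (conj_classes G)) class_count"
    and class_count_gen [simp]: "a \<in> S \<Longrightarrow> class_count (d a) = frag_of (conj_class G a)"
proof -
  interpret F: comm_group "free_Abelian_group (conj_classes G)" by (rule abelian_free_Abelian_group)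
  have frag_closed: "frag_of (conj_class G a) \<in> carrier (free_Abelian_group (conj_classes G))"
    if "a \<in> S" for a
    using S_closed[OF that] by (simp add: conj_classes_def)
  note lift = Q.As_lift[OF F.is_group, of "\<lambda>a. frag_of (conj_class G a)", folded class_count_def]
  show "group_hom D (free_Abelian_group (conj_classes G)) class_count"
    by (rule lift(1)) (use frag_closed in \<open>simp_all add: S_closed\<close>)
  show "a \<in> S \<Longrightarrow> class_count (d a) = frag_of (conj_class G a)"
    by (rule lift(2)) (use frag_closed in \<open>simp_all add: S_closed\<close>)
qed

lemma gen_conjugate:
  assumes "a \<in> S" "w \<in> carrier D"
  shows "d a \<triangleleft>\<^bsub>D\<^esub> w = d (a \<triangleleft> proj w)"
proof -
  have gens: "d ` S \<subseteq> carrier D" by auto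
  have "w \<in> generate D (d ` S)" using assms(2) by (simp add: generate_As_gen)
  then show ?thesis
    using assms(1)
  proof (induction arbitrary: a)
    case one
    then show ?case by (simp add: S_closed)
  next
    case (incl w)
    then show ?case by (auto simp: Q.As_gen_conjugate)
  next
    case (inv w)
    then obtain b where b: "b \<in> S" "w = d b" by blast
    then have a: "a \<triangleleft> inv b \<in> S" using inv.prems S_closed S_conjugate by simp
    have "d a = d (a \<triangleleft> inv b) \<triangleleft>\<^bsub>D\<^esub> d b"
      using a b inv.prems by (simp add: Q.As_gen_conjugate S_closed)
    then show ?case using a b by (simp add: S_closed)
  next
    case (eng v w)
    then have "v \<in> carrier D" "w \<in> carrier D" using D.generate_in_carrier[OF gens] by simp_all
    then show ?case
      using eng.IH eng.prems
      by (simp add: D.conjugate_by_mult conjugate_by_mult S_closed S_conjugate)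
  qed
qed

lemma kernel_proj_subset_center: "kernel D G proj \<subseteq> center D"
proof
  fix z assume "z \<in> kernel D G proj"
  then have z: "z \<in> carrier D" "proj z = \<one>" by (simp_all add: kernel_def)
  have "z \<in> centralizer D (d ` S)"
    using z by (auto simp: D.in_centralizer_iff_conjugate gen_conjugate S_closed image_subset_iff)
  moreover have "d ` S \<subseteq> carrier D" by auto
  ultimately show "z \<in> center D" using D.centralizer_generate[of "d ` S"]
    by (simp add: generate_As_gen)
qed

lemma proj_image_generate: "proj ` generate D (d ` \<Gamma>) = generate G \<Gamma>"
proof -
  have "d ` \<Gamma> \<subseteq> carrier D" "proj ` d ` \<Gamma> = \<Gamma>" using gens_subset_S by (force simp: image_image)+
  then show ?thesis using proj.generate_img[of "d ` \<Gamma>"] by simp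
qed

lemma generate_Dehn_group:
  assumes "generate G \<Gamma> = carrier G"
  shows "generate D (d ` \<Gamma>) = carrier D"
proof -
  let ?H = "generate D (d ` \<Gamma>)"
  have gens: "d ` \<Gamma> \<subseteq> carrier D" using gens_subset_S by auto
  have H: "subgroup ?H D" by (rule D.generate_is_subgroup[OF gens])
  have "d a \<in> ?H" if "a \<in> S" for a
  proof -
    from that obtain b g where b: "b \<in> \<Gamma>" and "g \<in> carrier G" "a = b \<triangleleft> g"
      by (auto simp: carrier_Dehn_quandle conj_class_eq_image_conjugate)
    moreover from this obtain w where w: "w \<in> ?H" "g = proj w"
      using proj_image_generate assms by blast
    moreover from this have "w \<in> carrier D" using D.generate_in_carrier[OF gens] by blast
    ultimately have "d a = d b \<triangleleft>\<^bsub>D\<^esub> w" using gens_subset_S by (auto simp: gen_conjugate)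
    also have "\<dots> \<in> ?H"
      unfolding conjugate_def using b w(1)
      by (intro generate.eng D.generate_m_inv_closed[OF gens]) (auto intro: generate.incl)
    finally show ?thesis .
  qed
  then have "carrier D \<subseteq> ?H"
    using D.generate_subgroup_incl[OF _ H, of "d ` S"] by (auto simp: generate_As_gen)
  then show ?thesis using D.generate_incl[OF gens] by blast
qed

lemma proj_surj: "generate G \<Gamma> = carrier G \<Longrightarrow> proj ` carrier D = carrier G"
  using proj_image_generate by (simp add: generate_Dehn_group)

end


section \<open>Splitting the structure group of the conjugation quandle\<close>

locale dehn_section = dehn +
  fixes \<sigma> :: "'a \<Rightarrow> 'a word set"
  assumes section_closed [simp]: "g \<in> carrier G \<Longrightarrow> \<sigma> g \<in> carrier D"
    and proj_section [simp]: "g \<in> carrier G \<Longrightarrow> proj (\<sigma> g) = g"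
    and section_gen: "a \<in> S \<Longrightarrow> \<sigma> a = d a"
    and section_conjugate: "g \<in> carrier G \<Longrightarrow> h \<in> carrier G \<Longrightarrow> \<sigma> (g \<triangleleft> h) = \<sigma> g \<triangleleft>\<^bsub>D\<^esub> \<sigma> h"

lemma (in dehn) dehn_section_exists:
  assumes "proj ` carrier D = carrier G"
    and "\<And>x. x \<in> carrier D \<Longrightarrow> inj_on proj (conj_class D x)"
  shows "\<exists>\<sigma>. dehn_section G \<Gamma> \<sigma>"
proof -
  obtain \<sigma> where \<sigma>: "\<And>g. g \<in> carrier G \<Longrightarrow> \<sigma> g \<in> carrier D" "\<And>g. g \<in> carrier G \<Longrightarrow> proj (\<sigma> g) = g"
    "\<And>g w. g \<in> carrier G \<Longrightarrow> w \<in> carrier D \<Longrightarrow> \<sigma> (g \<triangleleft> proj w) = \<sigma> g \<triangleleft>\<^bsub>D\<^esub> w"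
    by (rule proj.equivariant_section[OF assms]) blast+
  define \<tau> where "\<tau> g = (if g \<in> S then d g else \<sigma> g)" for g
  have \<tau>: "\<tau> g \<in> carrier D" "proj (\<tau> g) = g" if "g \<in> carrier G" for g
    using that \<sigma>(1,2) by (simp_all add: \<tau>_def)
  have "\<tau> (g \<triangleleft> h) = \<tau> g \<triangleleft>\<^bsub>D\<^esub> \<tau> h" if gh: "g \<in> carrier G" "h \<in> carrier G" for g h
  proof (cases "g \<in> S")
    case True
    then show ?thesis
      using gh \<tau> S_conjugate by (simp add: \<tau>_def[of g] \<tau>_def[of "g \<triangleleft> h"] gen_conjugate)
  next
    case False
    then show ?thesis
      using gh \<sigma>(3)[of g "\<tau> h"] \<tau> S_conjugate_iff by (simp add: \<tau>_def[of g] \<tau>_def[of "g \<triangleleft> h"])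
  qed
  with \<tau> have "dehn_section G \<Gamma> \<tau>" by unfold_locales (simp_all add: \<tau>_def)
  then show ?thesis by blast
qed

context dehn_section
begin

sublocale A: dehn G "carrier G"
  by unfold_locales simp

lemma A_S [simp]: "A.S = carrier G"
  by (simp add: Dehn_quandle_carrier)

definition emb :: "'a word set \<Rightarrow> 'a word set" where
  "emb = As_lift (Dehn_quandle G \<Gamma>) A.D A.d"

sublocale emb: group_hom D A.D emb
  unfolding emb_def
  by (rule Q.group_hom_As_lift) (simp_all add: A.D.is_group S_closed A.Q.As_gen_conjugate)

lemma emb_gen: "a \<in> S \<Longrightarrow> emb (d a) = A.d a"
  unfolding emb_def
  by (rule Q.As_lift_gen) (simp_all add: A.D.is_group S_closed A.Q.As_gen_conjugate)

lemma proj_emb: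
  assumes "x \<in> carrier D"
  shows "A.proj (emb x) = proj x"
proof -
  have "(A.proj \<circ> emb) x = proj x"
  proof (rule hom_eq_on_As[OF _ proj.group_hom_axioms _ assms])
    show "group_hom D G (A.proj \<circ> emb)"
      by (rule group_hom_compose[OF emb.group_hom_axioms A.proj.group_hom_axioms])
  qed (simp add: emb_gen S_closed)
  then show ?thesis by simp
qed

definition defect :: "'a \<Rightarrow> 'a word set" where
  "defect a = A.d a \<otimes>\<^bsub>A.D\<^esub> inv\<^bsub>A.D\<^esub> emb (\<sigma> a)"

lemma defect_center:
  assumes "a \<in> carrier G"
  shows "defect a \<in> center A.D"
proof -
  have "defect a \<in> kernel A.D G A.proj"
    using assms by (simp add: defect_def kernel_def proj_emb)
  then show ?thesis using A.kernel_proj_subset_center by blast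
qed

lemma defect_mult: "a \<in> carrier G \<Longrightarrow> defect a \<otimes>\<^bsub>A.D\<^esub> emb (\<sigma> a) = A.d a"
  by (simp add: defect_def A.D.m_assoc)

lemma defect_conjugate:
  assumes "a \<in> carrier G" "g \<in> carrier G"
  shows "defect (a \<triangleleft> g) = defect a"
proof -
  let ?w = "emb (\<sigma> g)"
  have "defect (a \<triangleleft> g) = (A.d a \<triangleleft>\<^bsub>A.D\<^esub> ?w) \<otimes>\<^bsub>A.D\<^esub> inv\<^bsub>A.D\<^esub> (emb (\<sigma> a) \<triangleleft>\<^bsub>A.D\<^esub> ?w)"
    using assms by (simp add: defect_def section_conjugate A.gen_conjugate proj_emb)
  also have "\<dots> = defect a \<triangleleft>\<^bsub>A.D\<^esub> ?w"
    using assms by (simp add: defect_def A.D.mult_conjugate A.D.inv_conjugate)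
  also have "\<dots> = defect a"
    using assms by (simp add: A.D.conjugate_center defect_center)
  finally show ?thesis .
qed

lemma defect_eq_if_conj_class_eq:
  assumes "a \<in> carrier G" "b \<in> carrier G" "conj_class G a = conj_class G b"
  shows "defect a = defect b"
proof -
  have "a \<in> conj_class G b" using assms by (simp add: conj_class_eq_iff)
  then show ?thesis using assms(2) by (auto simp: conj_class_eq_image_conjugate defect_conjugate)
qed

abbreviation F :: "('a set \<Rightarrow>\<^sub>0 int) monoid" where
  "F \<equiv> free_Abelian_group (nongen_classes G \<Gamma>)"

sublocale F: comm_group F
  by (rule abelian_free_Abelian_group)

sublocale DF: group "D \<times>\<times> F"
  by (rule DirProd_group[OF D.is_group F.is_group])

definition split :: "'a word set \<Rightarrow> 'a word set \<times> ('a set \<Rightarrow>\<^sub>0 int)" where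
  "split = As_lift (Dehn_quandle G (carrier G)) (D \<times>\<times> F)
     (\<lambda>a. (\<sigma> a, if a \<in> S then 0 else frag_of (conj_class G a)))"

lemma
  shows group_hom_split: "group_hom A.D (D \<times>\<times> F) split"
    and split_gen: "a \<in> carrier G \<Longrightarrow>
      split (A.d a) = (\<sigma> a, if a \<in> S then 0 else frag_of (conj_class G a))"
proof -
  let ?f = "\<lambda>a. (\<sigma> a, if a \<in> S then 0 else frag_of (conj_class G a))"
  have f: "?f a \<in> carrier (D \<times>\<times> F)" if "a \<in> carrier G" for a
    using that by (simp add: nongen_classes_eq)
  have conj: "?f a \<triangleleft>\<^bsub>D \<times>\<times> F\<^esub> ?f b = ?f (a \<triangleleft> b)" if "a \<in> carrier G" "b \<in> carrier G" for a b
  proof (rule DF.conjugate_eq_iff[THEN iffD2])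
    have "\<sigma> a \<otimes>\<^bsub>D\<^esub> \<sigma> b = \<sigma> b \<otimes>\<^bsub>D\<^esub> \<sigma> (a \<triangleleft> b)"
      using that D.conjugate_eq_iff[of "\<sigma> a" "\<sigma> (a \<triangleleft> b)" "\<sigma> b"] by (simp add: section_conjugate)
    then show "?f a \<otimes>\<^bsub>D \<times>\<times> F\<^esub> ?f b = ?f b \<otimes>\<^bsub>D \<times>\<times> F\<^esub> ?f (a \<triangleleft> b)"
      using that by (simp add: S_conjugate_iff add.commute)
  qed (use that in \<open>simp_all add: nongen_classes_eq S_conjugate_iff\<close>)
  note lift = A.Q.As_lift[OF DF.is_group, of ?f, folded split_def]
  show "group_hom A.D (D \<times>\<times> F) split"
    by (rule lift(1)) (use f conj in simp_all)
  show "a \<in> carrier G \<Longrightarrow> split (A.d a) = ?f a"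
    by (rule lift(2)) (use f conj in simp_all)
qed

sublocale split: group_hom A.D "D \<times>\<times> F" split
  by (rule group_hom_split)

lemma split_emb:
  assumes "x \<in> carrier D"
  shows "split (emb x) = (x, 0)"
proof -
  have "(split \<circ> emb) x = (x, 0)"
  proof (rule hom_eq_on_As[OF _ _ _ assms])
    show "group_hom D (D \<times>\<times> F) (split \<circ> emb)"
      by (rule group_hom_compose[OF emb.group_hom_axioms group_hom_split])
    show "group_hom D (D \<times>\<times> F) (\<lambda>x. (x, 0))" by unfold_locales (rule homI; simp)
  qed (simp add: emb_gen split_gen section_gen S_closed)
  then show ?thesis by simp
qed

lemma split_defect:
  assumes "a \<in> carrier G" "a \<notin> S"
  shows "split (defect a) = (\<one>\<^bsub>D\<^esub>, frag_of (conj_class G a))"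
  using assms
  by (simp add: defect_def split_emb split_gen inv_DirProd[OF D.is_group F.is_group])

lemma hom_extending_defect:
  obtains \<theta> where "group_hom F A.D \<theta>" "\<theta> ` carrier F \<subseteq> center A.D"
    "\<And>a. a \<in> carrier G \<Longrightarrow> a \<notin> S \<Longrightarrow> \<theta> (frag_of (conj_class G a)) = defect a"
proof -
  obtain f where f: "\<And>a. a \<in> carrier G \<Longrightarrow> f (conj_class G a) = defect a"
    using function_factors_left_gen[of "\<lambda>a. a \<in> carrier G" "conj_class G" defect]
      defect_eq_if_conj_class_eq by metis
  have "f ` nongen_classes G \<Gamma> \<subseteq> center A.D" by (auto simp: nongen_classes_eq f defect_center)
  then obtain \<theta> where "group_hom F A.D \<theta>" "\<theta> ` carrier F \<subseteq> center A.D"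
    "\<And>C. C \<in> nongen_classes G \<Gamma> \<Longrightarrow> \<theta> (frag_of C) = f C"
    by (rule A.D.free_Abelian_group_universal_center) blast
  then show thesis by (intro that) (auto simp: nongen_classes_eq f)
qed

lemma split_right_inverse:
  obtains merge where "group_hom (D \<times>\<times> F) A.D merge"
    "\<And>p. p \<in> carrier (D \<times>\<times> F) \<Longrightarrow> split (merge p) = p"
    "\<And>x. x \<in> carrier D \<Longrightarrow> merge (x, 0) = emb x"
    "\<And>x a. x \<in> carrier D \<Longrightarrow> a \<in> carrier G \<Longrightarrow> a \<notin> S \<Longrightarrow>
      merge (x, frag_of (conj_class G a)) = defect a \<otimes>\<^bsub>A.D\<^esub> emb x"
proof -
  obtain \<theta> where "group_hom F A.D \<theta>" and \<theta>_center: "\<theta> ` carrier F \<subseteq> center A.D"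
    and \<theta>_gen: "\<And>a. a \<in> carrier G \<Longrightarrow> a \<notin> S \<Longrightarrow> \<theta> (frag_of (conj_class G a)) = defect a"
    by (rule hom_extending_defect) blast
  then interpret \<theta>: group_hom F A.D \<theta> by simp
  define merge where "merge = (\<lambda>(x, c). emb x \<otimes>\<^bsub>A.D\<^esub> \<theta> c)"
  have commute: "emb x \<otimes>\<^bsub>A.D\<^esub> \<theta> c = \<theta> c \<otimes>\<^bsub>A.D\<^esub> emb x" if "x \<in> carrier D" "c \<in> carrier F" for x c
    using \<theta>_center that by (intro center_commute[symmetric] emb.hom_closed) auto
  have split_\<theta>: "(split \<circ> \<theta>) c = (\<one>\<^bsub>D\<^esub>, c)" if "c \<in> carrier F" for c
  proof (rule hom_eq_on_free_Abelian_group[OF _ _ _ that])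
    show "group_hom F (D \<times>\<times> F) (split \<circ> \<theta>)"
      by (rule group_hom_compose[OF \<theta>.group_hom_axioms group_hom_split])
    show "group_hom F (D \<times>\<times> F) (\<lambda>c. (\<one>\<^bsub>D\<^esub>, c))" by unfold_locales (rule homI; simp)
  qed (auto simp: nongen_classes_eq \<theta>_gen split_defect)
  show thesis
  proof
    have "merge \<in> hom (D \<times>\<times> F) A.D"
      unfolding merge_def by (rule A.D.hom_DirProd_commuting[OF emb.homh \<theta>.homh commute])
    then show "group_hom (D \<times>\<times> F) A.D merge" by unfold_locales
    show "split (merge p) = p" if "p \<in> carrier (D \<times>\<times> F)" for p
      using that split_\<theta>[of "snd p"] \<theta>.hom_closed[of "snd p"] by (auto simp: merge_def split_emb)
    show "merge (x, 0) = emb x" if "x \<in> carrier D" for x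
      using that \<theta>.hom_one by (simp add: merge_def)
    show "merge (x, frag_of (conj_class G a)) = defect a \<otimes>\<^bsub>A.D\<^esub> emb x"
      if "x \<in> carrier D" "a \<in> carrier G" "a \<notin> S" for x a
      using that commute[of x "frag_of (conj_class G a)"]
      by (simp add: merge_def \<theta>_gen nongen_classes_eq)
  qed
qed

theorem As_Conj_iso: "As (Conj G) \<cong> D \<times>\<times> F"
proof -
  obtain merge where "group_hom (D \<times>\<times> F) A.D merge"
    and split_merge: "\<And>p. p \<in> carrier (D \<times>\<times> F) \<Longrightarrow> split (merge p) = p"
    and merge_emb: "\<And>x. x \<in> carrier D \<Longrightarrow> merge (x, 0) = emb x"
    and merge_frag: "\<And>x a. x \<in> carrier D \<Longrightarrow> a \<in> carrier G \<Longrightarrow> a \<notin> S \<Longrightarrow>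
      merge (x, frag_of (conj_class G a)) = defect a \<otimes>\<^bsub>A.D\<^esub> emb x"
    by (rule split_right_inverse) blast
  then interpret merge: group_hom "D \<times>\<times> F" A.D merge by simp
  have "(merge \<circ> split) y = y" if "y \<in> carrier A.D" for y
  proof (rule hom_eq_on_As[OF _ _ _ that])
    show "group_hom A.D A.D (merge \<circ> split)"
      by (rule group_hom_compose[OF group_hom_split merge.group_hom_axioms])
    show "group_hom A.D A.D (\<lambda>y. y)" by unfold_locales (rule homI; simp)
    show "(merge \<circ> split) (A.d a) = A.d a" if "a \<in> A.S" for a
      using that by (cases "a \<in> S")
        (simp_all add: split_gen merge_emb merge_frag section_gen emb_gen defect_mult)
  qed
  then have "group_isomorphisms A.D (D \<times>\<times> F) split merge"
    using split.homh merge.homh split_merge by (simp add: group_isomorphisms_def)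
  then show ?thesis
    using is_isoI[OF group_isomorphisms_imp_iso] by (simp add: Dehn_quandle_carrier)
qed

end

theorem (in dehn) As_Conj_iso_if_inj_on_conj_class:
  assumes "proj ` carrier D = carrier G"
    and "\<And>x. x \<in> carrier D \<Longrightarrow> inj_on proj (conj_class D x)"
  shows "As (Conj G) \<cong> D \<times>\<times> free_Abelian_group (nongen_classes G \<Gamma>)"
proof -
  obtain \<sigma> where "dehn_section G \<Gamma> \<sigma>" using dehn_section_exists[OF assms] by blast
  then show ?thesis by (rule dehn_section.As_Conj_iso)
qed


section \<open>Groups with a \<open>C\<close>-bar-type presentation\<close>

locale Cbar_group = group G for G (structure) +
  fixes X :: "'x set" and R :: "('x word \<times> 'x word) set" and \<iota> :: "'x \<Rightarrow> 'a"
  assumes Cbar_presentation: "Cbar_presentation G X R \<iota>"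
begin

lemma presentation: "is_presentation G X R \<iota>"
  using Cbar_presentation by (simp add: Cbar_presentation_def)

lemmas gen_closed [simp] = is_presentation_closed[OF is_group presentation]
lemmas eval_word_rel = is_presentation_rel[OF is_group presentation]
lemmas generate_gens = is_presentation_generate[OF is_group presentation]

sublocale dehn G "\<iota> ` X"
  by unfold_locales auto

lemma gen_in_S [simp]: "x \<in> X \<Longrightarrow> \<iota> x \<in> S"
  using gens_subset_S by blast

lemma relation_cases:
  assumes "(l, r) \<in> R"
  obtains (conj) a b c where "a \<in> X" "b \<in> X" "c \<in> X" "(l, r) = conj_relation a b c"
  | (power) a k where "a \<in> X" "k \<ge> 2" "(l, r) = power_relation a k"
  using Cbar_presentation assms by (auto simp: Cbar_presentation_def)

lemma conj_relation_imp_conjugate: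
  assumes "conj_relation a b c \<in> R" "a \<in> X" "b \<in> X" "c \<in> X"
  shows "\<iota> a \<triangleleft> \<iota> b = \<iota> c"
  using eval_word_rel[of "[(b, False), (a, True), (b, True)]" "[(c, True)]"] assms
  by (simp add: conj_relation_def conjugate_def m_assoc)

lemma power_relationD:
  assumes "power_relation a k \<in> R"
  shows "a \<in> X" "k > 0"
proof -
  have "(replicate k (a, True), []) \<in> R" using assms by (simp add: power_relation_def)
  then have "a \<in> X \<and> k > 0"
    by (cases rule: relation_cases)
      (auto simp: conj_relation_def power_relation_def replicate_eq_replicate)
  then show "a \<in> X" "k > 0" by simp_all
qed

lemma power_relation_unique:
  assumes R: "power_relation a k \<in> R" "power_relation b j \<in> R"
    and conj_class_eq: "conj_class G (\<iota> a) = conj_class G (\<iota> b)"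
  shows "(a, k) = (b, j)"
proof -
  have "\<iota> a \<in> carrier G" "\<iota> b \<in> carrier G"
    using R[THEN power_relationD(1)] by simp_all
  then have "conj_class G (\<iota> a) \<in> conj_classes G"
    "\<iota> a \<in> conj_class G (\<iota> a)" "\<iota> b \<in> conj_class G (\<iota> a)"
    using conj_class_self conj_class_eq by (auto simp: conj_classes_def)
  with R Cbar_presentation show ?thesis unfolding Cbar_presentation_def by blast
qed

lemma gen_pow_in_kernel:
  assumes "power_relation a k \<in> R"
  shows "d (\<iota> a) [^]\<^bsub>D\<^esub> k \<in> kernel D G proj"
proof -
  have a: "a \<in> X" using power_relationD[OF assms] by simp
  have "\<iota> a [^] k = \<one>"
    using eval_word_rel[of "replicate k (a, True)" "[]"] assms a
    by (simp add: power_relation_def eval_word_replicate)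
  then show ?thesis using a by (simp add: kernel_def proj.hom_nat_pow)
qed

lemma hom_factors_through_proj:
  assumes "group_hom D K \<pi>"
    and powers: "\<And>a k. power_relation a k \<in> R \<Longrightarrow> \<pi> (d (\<iota> a) [^]\<^bsub>D\<^esub> k) = \<one>\<^bsub>K\<^esub>"
  obtains h where "h \<in> hom G K" "\<And>x. x \<in> carrier D \<Longrightarrow> h (proj x) = \<pi> x"
proof -
  interpret \<pi>: group_hom D K \<pi> by fact
  let ?\<delta> = "\<lambda>x. d (\<iota> x)"
  have \<delta>: "?\<delta> \<in> X \<rightarrow> carrier D" by simp
  have "\<pi> (eval_word D ?\<delta> l) = \<pi> (eval_word D ?\<delta> r)" if "(l, r) \<in> R" for l r
    using that
  proof (cases rule: relation_cases)
    case (conj a b c)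
    then have "d (\<iota> a) \<triangleleft>\<^bsub>D\<^esub> d (\<iota> b) = d (\<iota> c)"
      using that by (simp add: gen_conjugate conj_relation_imp_conjugate)
    then show ?thesis
      using conj by (simp add: conj_relation_def conjugate_def D.m_assoc)
  next
    case (power a k)
    then have "\<pi> (d (\<iota> a) [^]\<^bsub>D\<^esub> k) = \<one>\<^bsub>K\<^esub>" using powers that by simp
    then show ?thesis
      using power \<pi>.hom_one by (simp add: power_relation_def D.eval_word_replicate)
  qed
  moreover have "l \<in> words X" "r \<in> words X" if "(l, r) \<in> R" for l r
    using that presentation by (auto simp: is_presentation_def)
  ultimately have "eval_word K (\<pi> \<circ> ?\<delta>) l = eval_word K (\<pi> \<circ> ?\<delta>) r" if "(l, r) \<in> R" for l r
    using that \<pi>.hom_eval_word[OF \<delta>] by metis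
  then obtain h where h: "h \<in> hom G K" "\<And>x. x \<in> X \<Longrightarrow> h (\<iota> x) = \<pi> (d (\<iota> x))"
    by (rule is_presentation_universal[OF is_group presentation \<pi>.H.is_group, of "\<pi> \<circ> ?\<delta>", rotated])
      auto
  have "(h \<circ> proj) x = \<pi> x" if "x \<in> carrier D" for x
  proof (rule hom_eq_on_generate[of D K _ _ "d ` \<iota> ` X"])
    show "group_hom D K (h \<circ> proj)"
      using Group.hom_compose[OF proj.homh h(1)] by unfold_locales
    show "x \<in> generate D (d ` \<iota> ` X)"
      using that by (simp add: generate_Dehn_group[OF generate_gens])
  qed (use h(2) \<pi>.group_hom_axioms in auto)
  with h(1) show thesis by (intro that) simp_all
qed

lemma kernel_proj_subset:
  assumes "N \<lhd> D" and powers: "\<And>a k. power_relation a k \<in> R \<Longrightarrow> d (\<iota> a) [^]\<^bsub>D\<^esub> k \<in> N"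
  shows "kernel D G proj \<subseteq> N"
proof
  interpret N: normal N D by fact
  have quotient: "group_hom D (D Mod N) (\<lambda>x. N #>\<^bsub>D\<^esub> x)"
    by (intro group_hom.intro group_hom_axioms.intro
        D.is_group N.factorgroup_is_group N.r_coset_hom_Mod)
  obtain h where h: "h \<in> hom G (D Mod N)" "\<And>x. x \<in> carrier D \<Longrightarrow> h (proj x) = N #>\<^bsub>D\<^esub> x"
    by (rule hom_factors_through_proj[OF quotient])
      (use D.coset_join2[OF _ N.is_subgroup] powers N.mem_carrier in auto)
  fix z assume "z \<in> kernel D G proj"
  then have z: "z \<in> carrier D" "proj z = \<one>" by (simp_all add: kernel_def)
  have "N #>\<^bsub>D\<^esub> z = N"
    using h(2)[OF z(1)] z(2) hom_one[OF h(1) is_group N.factorgroup_is_group] by simp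
  then show "z \<in> N" using D.rcos_self[OF z(1) N.is_subgroup] by simp
qed

lemma eq_one_if_proj_class_count:
  assumes "x \<in> carrier D" "proj x = \<one>" "class_count x = 0"
  shows "x = \<one>\<^bsub>D\<^esub>"
proof -
  define P where "P = {(a, k). power_relation a k \<in> R}"
  let ?F = "free_Abelian_group P" and ?C = "free_Abelian_group (conj_classes G)"
  have "(\<lambda>(a, k). d (\<iota> a) [^]\<^bsub>D\<^esub> k) ` P \<subseteq> center D"
    using gen_pow_in_kernel kernel_proj_subset_center by (auto simp: P_def)
  then obtain \<theta> where "group_hom ?F D \<theta>" and \<theta>_center: "\<theta> ` carrier ?F \<subseteq> center D"
    and \<theta>_gen: "\<And>p. p \<in> P \<Longrightarrow> \<theta> (frag_of p) = (case p of (a, k) \<Rightarrow> d (\<iota> a) [^]\<^bsub>D\<^esub> k)"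
    by (rule D.free_Abelian_group_universal_center) blast
  then interpret \<theta>: group_hom ?F D \<theta> by simp
  interpret count: group_hom D ?C class_count by (rule group_hom_class_count)
  have "inj_on (class_count \<circ> \<theta>) (carrier ?F)"
  proof (rule inj_on_hom_free_Abelian_group)
    show "group_hom ?F ?C (class_count \<circ> \<theta>)"
      by (rule group_hom_compose[OF \<theta>.group_hom_axioms group_hom_class_count])
    show "(class_count \<circ> \<theta>) (frag_of p)
        = frag_cmul (int (snd p)) (frag_of (conj_class G (\<iota> (fst p))))"
      if "p \<in> P" for p
      using that power_relationD
      by (auto simp: \<theta>_gen P_def count.hom_nat_pow conj_classes_def split: prod.splits)
    show "inj_on (\<lambda>p. conj_class G (\<iota> (fst p))) P"
      using power_relation_unique by (auto simp: inj_on_def P_def)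
  qed (auto simp: P_def dest: power_relationD)
  moreover obtain c where c: "c \<in> carrier ?F" "x = \<theta> c"
  proof -
    have "kernel D G proj \<subseteq> \<theta> ` carrier ?F"
    proof (rule kernel_proj_subset[OF D.subgroup_of_center_normal[OF \<theta>.img_is_subgroup \<theta>_center]])
      show "d (\<iota> a) [^]\<^bsub>D\<^esub> k \<in> \<theta> ` carrier ?F" if "power_relation a k \<in> R" for a k
        using that \<theta>_gen[of "(a, k)"]
        by (intro image_eqI[of _ \<theta> "frag_of (a, k)"]) (auto simp: P_def)
    qed
    with assms(1,2) that show thesis by (auto simp: kernel_def)
  qed
  moreover have "class_count (\<theta> c) = class_count (\<theta> 0)"
    using assms(3) c(2) \<theta>.hom_one count.hom_one by simp
  ultimately have "c = 0" by (simp add: inj_on_def)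
  then show ?thesis using c(2) \<theta>.hom_one by simp
qed

lemma inj_on_proj_conj_class: "x \<in> carrier D \<Longrightarrow> inj_on proj (conj_class D x)"
  using eq_one_if_proj_class_count group_hom.homh[OF group_hom_class_count]
  by (intro proj.inj_on_conj_class_if_separated[OF abelian_free_Abelian_group]) auto

end

theorem theorem3:
  fixes G :: "('a, 'm) monoid_scheme"
    and X :: "'x set" and R :: "('x word \<times> 'x word) set" and \<iota> :: "'x \<Rightarrow> 'a"
  assumes "group G"
    and "Cbar_presentation G X R \<iota>"
  shows "A_group G \<cong> Dehn_group G (\<iota> ` X) \<times>\<times> free_Abelian_group (nongen_classes G (\<iota> ` X))"
proof -
  interpret Cbar_group G X R \<iota>
    using assms by (simp add: Cbar_group_def Cbar_group_axioms_def)
  have "proj ` carrier D = carrier G"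
    by (rule proj_surj[OF generate_gens])
  then show ?thesis
    unfolding A_group_def Dehn_group_def
    by (rule As_Conj_iso_if_inj_on_conj_class[OF _ inj_on_proj_conj_class])
qed

end
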